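(* For any prime $p$ and any integer $n\ge 1$, $$\Delta(n,p)\equiv 0 \pmod{p-1}.$$
   Context: Here $\varphi$ denotes Euler's totient function, and for a prime $p$ and real $x\ge 1$, $\Delta(x,p)=\sum_{\substack{k\le x\\ p\mid k}}\varphi(k)$, the sum being over positive integers $k\le x$ divisible by $p$ (an empty sum is $0$). *)

theory Defs
  imports Complex_Main "HOL-Number_Theory.Number_Theory"
begin

definition Delta :: "real \<Rightarrow> nat \<Rightarrow> nat" where
  "Delta x p = (\<Sum>k | 0 < k \<and> real k \<le> x \<and> p dvd k. totient k)"

end

theory Submission
  imports Defs
begin

text \<open>The congruence already holds term by term: \<open>a dvd b\<close> implies
  \<open>totient a dvd totient b\<close>, so every \<open>k\<close> divisible by \<open>p\<close> has a totient
  divisible by \<open>totient p = p - 1\<close>.\<close>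

theorem proposition3p2:
  fixes p n :: nat
  assumes "prime p" and "n \<ge> 1"
  shows "[Delta (real n) p = 0] (mod (p - 1))"
proof -
  have "p - 1 dvd totient k" if "p dvd k" for k
    using totient_dvd[OF that] totient_prime[OF assms(1)] by simp
  then have "p - 1 dvd Delta (real n) p"
    unfolding Delta_def by (intro dvd_sum) simp
  then show ?thesis
    by (simp add: cong_0_iff)
qed

end
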